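(* Let $\mathfrak R$ be a Superposed Term Rewrite System (STRS) and let $t$ be a term. Suppose that there exist two terms $t_1,t_2$ such that $t\to_{\mathfrak R}^* t_1$ and $t\to_{\mathfrak R}^* t_2$. Then there exist two terms $t_3,t_4$ such that $t_1\to_{\mathfrak R}^* t_3$, $t_2\to_{\mathfrak R}^* t_4$ and $t_3\equiv t_4$.
   Context: **Syntax.** $\mathcal X$ is a countable set of variables; $\mathcal A,\mathcal C,\mathcal F$ are pairwise disjoint signatures (symbols $b$ with arity $\mathrm{ar}(b)\in\mathbb N$) of amplitude, constructor and function symbols. Constructors include a unit $()$, $|0\rangle$, $|1\rangle$, $\mathtt 0$ (arity 0), $\mathtt S$ (arity 1), pairing $(\cdot,\cdot)$ (arity 2), $[\,]$ (arity 0) and list-cons $h::t$ (arity 2). Grammar: naturals $\iota::=x\mid\mathtt 0\mid\mathtt S(\iota)$; amplitudes $\alpha::=\mathtt a(\iota,\dots,\iota)\mid\alpha\cdot\alpha\mid\alpha+\alpha$; terms $t::=x\mid c(t,\dots,t)\mid f(t,\dots,t)\mid\alpha\cdot t\mid t+t$; values $v::=c(v,\dots,v)\mid\alpha\cdot v\ (\alpha\text{ ground})\mid v+v$. A term or amplitude is ground if it has no variable; $\mathscr T_0$ is the set of ground terms. A term is classical if it contains neither $+$ nor $\alpha\cdot$. A substitution $\sigma$ maps variables to values. **Amplitudes.** Each $\mathtt a\in\mathcal A$ has a total interpretation $[\![\mathtt a]\!]:\mathbb N^{\mathrm{ar}(\mathtt a)}\to\mathbb C$, extended to ground amplitudes in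 the obvious way (sums to sums, products to products, $\mathtt S^n(\mathtt 0)$ to $n$). For a non-ground $\alpha$, $[\![\alpha]\!]=\lambda$ means $[\![\alpha\sigma]\!]=\lambda$ for every $\sigma$ such that $\alpha\sigma$ is a ground amplitude. $\mathtt a_\lambda$ denotes an arity-0 symbol with $[\![\mathtt a_\lambda]\!]=\lambda$. **Equivalence.** $\equiv$ is the smallest equivalence relation on terms, closed under all term contexts ($s\equiv t\Rightarrow C[s]\equiv C[t]$), with: $t_1+t_2\equiv t_2+t_1$; $t_1+(t_2+t_3)\equiv(t_1+t_2)+t_3$; $s+\alpha\cdot t\equiv s$ if $[\![\alpha]\!]=0$; $\alpha\cdot t\equiv t$ if $[\![\alpha]\!]=1$; $\alpha\cdot(\beta\cdot t)\equiv(\alpha\cdot\beta)\cdot t$; $\alpha\cdot(t_1+t_2)\equiv\alpha\cdot t_1+\alpha\cdot t_2$; $\alpha\cdot t+\beta\cdot t\equiv(\alpha+\beta)\cdot t$; and, for $b\in\mathcal C\uplus\mathcal F$, $b(\dots,\alpha\cdot t,\dots)\equiv\alpha\cdot b(\dots,t,\dots)$ and $b(\dots,t_1+t_2,\dots)\equiv b(\dots,t_1,\dots)+b(\dots,t_2,\dots)$. A canonical form of $t$ is a term $\sum_{i=1}^n\alpha_i\cdot t_i\equiv t$ with the $t_i$ pairwise distinct classical terms and $[\![\alpha_i]\!]\neq0$; $\mathrm{CAN}$ is the set of canonical forms. **STRS.** A rewrite rule is $l\to r$ with $l=f(p_1,\dots,p_n)$, $f\in\mathcal F$, each $p_i$ a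 classical term without function symbols, and $\mathrm{Var}(r)\subseteq\mathrm{Var}(l)$. An STRS $\mathfrak R$ consists of $\mathcal A,\mathcal C,\mathcal F,\mathcal X$, a set $\mathcal R$ of orthogonal rules (left-linear and with pairwise non-overlapping left-hand sides), and a main symbol $f\in\mathcal F$. **Reduction.** Evaluation contexts: $E::=\diamond\mid b(v_1,\dots,v_{i-1},E,t_{i+1},\dots,t_n)$ with $b\in\mathcal C\uplus\mathcal F$ and $v_j$ values. $\to_{\mathfrak R}\subseteq\mathscr T_0\times\mathscr T_0$ is defined inductively by: (C) if $l\to r\in\mathcal R$ and $E[l\sigma]$ is classical then $E[l\sigma]\to_{\mathfrak R}E[r\sigma]$; (E) if $s\equiv s'\to_{\mathfrak R}t'\equiv t$ then $s\to_{\mathfrak R}t$; (Q) if $\sum_i\alpha_i\cdot s_i\in\mathrm{CAN}$, $s_i\to^?_{\mathfrak R}t_i$ for all $i$, and $s_i\to_{\mathfrak R}t_i$ for some $i$, then $\sum_i\alpha_i\cdot s_i\to_{\mathfrak R}\sum_i\alpha_i\cdot t_i$. Here $s\to^?_{\mathfrak R}t$ iff ($s\in\mathrm{NF}_{\mathfrak R}$ and $t=s$) or $s\to_{\mathfrak R}t$, and $\mathrm{NF}_{\mathfrak R}$ is the set of ground terms with no $\to_{\mathfrak R}$-reduct. $\to^*_{\mathfrak R}$ is the reflexive transitive closure.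
   Formalization: The STRS is additionally assumed to have some ground amplitude of value −1 (e.g. the symbol a_{−1}); for arbitrary amplitude symbols, e.g. two constants of values 2 and 3 with the rule f(x,y)→0, the claim fails. *)

theory Defs
  imports Complex_Main "HOL-Library.Countable"
begin

section \<open>Syntax\<close>

text \<open>
  Raw terms and amplitudes over variables \<open>'x\<close>, amplitude symbols \<open>'a\<close>, constructor symbols \<open>'c\<close>
  and function symbols \<open>'f\<close>; a symbol in the disjoint union of constructors and functions is an
  element of \<open>'c + 'f\<close>.  Arities, and the requirement that arguments of amplitude symbols are
  naturals, are imposed by the predicates \<open>is_trm\<close> and \<open>is_amp\<close> below.
\<close>

datatype (vars_trm: 'x, dead 'a, dead 'c, funs_trm: 'f) trm =
    Var 'x
  | App "'c + 'f" "('x, 'a, 'c, 'f) trm list"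
  | Scale "('x, 'a, 'c, 'f) amp" "('x, 'a, 'c, 'f) trm"
  | Plus "('x, 'a, 'c, 'f) trm" "('x, 'a, 'c, 'f) trm"
and (vars_amp: 'x, dead 'a, dead 'c, funs_amp: 'f) amp =
    Amp 'a "('x, 'a, 'c, 'f) trm list"
  | AMul "('x, 'a, 'c, 'f) amp" "('x, 'a, 'c, 'f) amp"
  | AAdd "('x, 'a, 'c, 'f) amp" "('x, 'a, 'c, 'f) amp"

abbreviation Con :: "'c \<Rightarrow> ('x, 'a, 'c, 'f) trm list \<Rightarrow> ('x, 'a, 'c, 'f) trm" where
  "Con c ts \<equiv> App (Inl c) ts"

abbreviation Fun :: "'f \<Rightarrow> ('x, 'a, 'c, 'f) trm list \<Rightarrow> ('x, 'a, 'c, 'f) trm" where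
  "Fun f ts \<equiv> App (Inr f) ts"

text \<open>
  \<open>amp_int R a\<close> is only used on lists of length \<open>amp_ar R a\<close>.
\<close>

record ('x, 'a, 'c, 'f) strs =
  amp_ar :: "'a \<Rightarrow> nat"
  amp_int :: "'a \<Rightarrow> nat list \<Rightarrow> complex"
  con_ar :: "'c \<Rightarrow> nat"
  fun_ar :: "'f \<Rightarrow> nat"
  unit_con :: 'c
  ket0_con :: 'c
  ket1_con :: 'c
  zero_con :: 'c
  suc_con :: 'c
  pair_con :: 'c
  nil_con :: 'c
  cons_con :: 'c
  rules :: "(('x, 'a, 'c, 'f) trm \<times> ('x, 'a, 'c, 'f) trm) set"
  main_fun :: 'f

fun sym_ar :: "('x, 'a, 'c, 'f) strs \<Rightarrow> 'c + 'f \<Rightarrow> nat" where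
  "sym_ar R (Inl c) = con_ar R c"
| "sym_ar R (Inr f) = fun_ar R f"

inductive is_natural :: "('x, 'a, 'c, 'f) strs \<Rightarrow> ('x, 'a, 'c, 'f) trm \<Rightarrow> bool" for R where
  "is_natural R (Var x)"
| "is_natural R (Con (zero_con R) [])"
| "is_natural R n \<Longrightarrow> is_natural R (Con (suc_con R) [n])"

inductive is_amp :: "('x, 'a, 'c, 'f) strs \<Rightarrow> ('x, 'a, 'c, 'f) amp \<Rightarrow> bool" for R where
  "length ns = amp_ar R a \<Longrightarrow> \<forall>n\<in>set ns. is_natural R n \<Longrightarrow> is_amp R (Amp a ns)"
| "is_amp R \<alpha> \<Longrightarrow> is_amp R \<beta> \<Longrightarrow> is_amp R (AMul \<alpha> \<beta>)"
| "is_amp R \<alpha> \<Longrightarrow> is_amp R \<beta> \<Longrightarrow> is_amp R (AAdd \<alpha> \<beta>)"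

inductive is_trm :: "('x, 'a, 'c, 'f) strs \<Rightarrow> ('x, 'a, 'c, 'f) trm \<Rightarrow> bool" for R where
  "is_trm R (Var x)"
| "length ts = sym_ar R b \<Longrightarrow> \<forall>t\<in>set ts. is_trm R t \<Longrightarrow> is_trm R (App b ts)"
| "is_amp R \<alpha> \<Longrightarrow> is_trm R t \<Longrightarrow> is_trm R (Scale \<alpha> t)"
| "is_trm R s \<Longrightarrow> is_trm R t \<Longrightarrow> is_trm R (Plus s t)"

inductive is_value :: "('x, 'a, 'c, 'f) strs \<Rightarrow> ('x, 'a, 'c, 'f) trm \<Rightarrow> bool" for R where
  "length vs = con_ar R c \<Longrightarrow> \<forall>v\<in>set vs. is_value R v \<Longrightarrow> is_value R (Con c vs)"
| "is_amp R \<alpha> \<Longrightarrow> vars_amp \<alpha> = {} \<Longrightarrow> is_value R v \<Longrightarrow> is_value R (Scale \<alpha> v)"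
| "is_value R v \<Longrightarrow> is_value R w \<Longrightarrow> is_value R (Plus v w)"

definition ground_trms :: "('x, 'a, 'c, 'f) strs \<Rightarrow> ('x, 'a, 'c, 'f) trm set" where
  "ground_trms R = {t. is_trm R t \<and> vars_trm t = {}}"

fun classical :: "('x, 'a, 'c, 'f) trm \<Rightarrow> bool" where
  "classical (Var x) = True"
| "classical (App b ts) = (\<forall>t\<in>set ts. classical t)"
| "classical (Scale \<alpha> t) = False"
| "classical (Plus s t) = False"

text \<open>
  Application of a map from variables to terms.  The result may violate the grammar when a variable
  occurring in an amplitude is mapped to something other than a natural; every use below demands
  well-formedness of the instance wherever it matters.
\<close>

primrec subst_trm ::
    "('x \<Rightarrow> ('y, 'a, 'c, 'f) trm) \<Rightarrow> ('x, 'a, 'c, 'f) trm \<Rightarrow> ('y, 'a, 'c, 'f) trm"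
  and subst_amp ::
    "('x \<Rightarrow> ('y, 'a, 'c, 'f) trm) \<Rightarrow> ('x, 'a, 'c, 'f) amp \<Rightarrow> ('y, 'a, 'c, 'f) amp" where
  "subst_trm \<sigma> (Var x) = \<sigma> x"
| "subst_trm \<sigma> (App b ts) = App b (map (subst_trm \<sigma>) ts)"
| "subst_trm \<sigma> (Scale \<alpha> t) = Scale (subst_amp \<sigma> \<alpha>) (subst_trm \<sigma> t)"
| "subst_trm \<sigma> (Plus s t) = Plus (subst_trm \<sigma> s) (subst_trm \<sigma> t)"
| "subst_amp \<sigma> (Amp a ts) = Amp a (map (subst_trm \<sigma>) ts)"
| "subst_amp \<sigma> (AMul \<alpha> \<beta>) = AMul (subst_amp \<sigma> \<alpha>) (subst_amp \<sigma> \<beta>)"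
| "subst_amp \<sigma> (AAdd \<alpha> \<beta>) = AAdd (subst_amp \<sigma> \<alpha>) (subst_amp \<sigma> \<beta>)"

definition is_subst ::
    "('x, 'a, 'c, 'f) strs \<Rightarrow> ('x \<Rightarrow> ('x, 'a, 'c, 'f) trm) \<Rightarrow> bool" where
  "is_subst R \<sigma> \<longleftrightarrow> (\<forall>x. is_value R (\<sigma> x))"


section \<open>Amplitudes\<close>

text \<open>
  The next two functions are only meaningful on ground naturals, i.e. numerals built from
  \<open>zero_con R\<close> and \<open>suc_con R\<close>, and on ground amplitudes, respectively.
\<close>

fun nat_val :: "('x, 'a, 'c, 'f) trm \<Rightarrow> nat" where
  "nat_val (App b [t]) = Suc (nat_val t)"
| "nat_val _ = 0"

fun amp_val :: "('x, 'a, 'c, 'f) strs \<Rightarrow> ('x, 'a, 'c, 'f) amp \<Rightarrow> complex" where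
  "amp_val R (Amp a ns) = amp_int R a (map nat_val ns)"
| "amp_val R (AMul \<alpha> \<beta>) = amp_val R \<alpha> * amp_val R \<beta>"
| "amp_val R (AAdd \<alpha> \<beta>) = amp_val R \<alpha> + amp_val R \<beta>"

definition amp_denotes ::
    "('x, 'a, 'c, 'f) strs \<Rightarrow> ('x, 'a, 'c, 'f) amp \<Rightarrow> complex \<Rightarrow> bool" where
  "amp_denotes R \<alpha> z \<longleftrightarrow>
     (\<forall>\<sigma>. is_subst R \<sigma> \<and> is_amp R (subst_amp \<sigma> \<alpha>) \<and> vars_amp (subst_amp \<sigma> \<alpha>) = {} \<longrightarrow>
        amp_val R (subst_amp \<sigma> \<alpha>) = z)"


section \<open>Equivalence and canonical forms\<close>

text \<open>
  The premises \<open>is_trm R _\<close> keep the relation on well-formed terms; the rules \<open>cong_*\<close> amount to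
  closure under arbitrary one-hole term contexts.
\<close>

inductive eqv ::
    "('x, 'a, 'c, 'f) strs \<Rightarrow> ('x, 'a, 'c, 'f) trm \<Rightarrow> ('x, 'a, 'c, 'f) trm \<Rightarrow> bool" for R where
  refl: "is_trm R t \<Longrightarrow> eqv R t t"
| sym: "eqv R s t \<Longrightarrow> eqv R t s"
| trans: "eqv R s t \<Longrightarrow> eqv R t u \<Longrightarrow> eqv R s u"
| cong_App: "eqv R s t \<Longrightarrow> is_trm R (App b (us @ s # ws)) \<Longrightarrow>
    eqv R (App b (us @ s # ws)) (App b (us @ t # ws))"
| cong_Scale: "eqv R s t \<Longrightarrow> is_amp R \<alpha> \<Longrightarrow> eqv R (Scale \<alpha> s) (Scale \<alpha> t)"
| cong_Plus1: "eqv R s t \<Longrightarrow> is_trm R u \<Longrightarrow> eqv R (Plus s u) (Plus t u)"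
| cong_Plus2: "eqv R s t \<Longrightarrow> is_trm R u \<Longrightarrow> eqv R (Plus u s) (Plus u t)"
| comm: "is_trm R (Plus s t) \<Longrightarrow> eqv R (Plus s t) (Plus t s)"
| assoc: "is_trm R (Plus s (Plus t u)) \<Longrightarrow> eqv R (Plus s (Plus t u)) (Plus (Plus s t) u)"
| zero: "is_trm R (Plus s (Scale \<alpha> t)) \<Longrightarrow> amp_denotes R \<alpha> 0 \<Longrightarrow> eqv R (Plus s (Scale \<alpha> t)) s"
| one: "is_trm R (Scale \<alpha> t) \<Longrightarrow> amp_denotes R \<alpha> 1 \<Longrightarrow> eqv R (Scale \<alpha> t) t"
| mult: "is_trm R (Scale \<alpha> (Scale \<beta> t)) \<Longrightarrow>
    eqv R (Scale \<alpha> (Scale \<beta> t)) (Scale (AMul \<alpha> \<beta>) t)"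
| distrib: "is_trm R (Scale \<alpha> (Plus s t)) \<Longrightarrow>
    eqv R (Scale \<alpha> (Plus s t)) (Plus (Scale \<alpha> s) (Scale \<alpha> t))"
| factor: "is_trm R (Plus (Scale \<alpha> t) (Scale \<beta> t)) \<Longrightarrow>
    eqv R (Plus (Scale \<alpha> t) (Scale \<beta> t)) (Scale (AAdd \<alpha> \<beta>) t)"
| lin_Scale: "is_trm R (App b (us @ Scale \<alpha> t # ws)) \<Longrightarrow>
    eqv R (App b (us @ Scale \<alpha> t # ws)) (Scale \<alpha> (App b (us @ t # ws)))"
| lin_Plus: "is_trm R (App b (us @ Plus s t # ws)) \<Longrightarrow>
    eqv R (App b (us @ Plus s t # ws)) (Plus (App b (us @ s # ws)) (App b (us @ t # ws)))"

text \<open>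
  Nonempty linear combinations, unspecified on the empty list.
\<close>

fun lincomb ::
    "(('x, 'a, 'c, 'f) amp \<times> ('x, 'a, 'c, 'f) trm) list \<Rightarrow> ('x, 'a, 'c, 'f) trm" where
  "lincomb [] = undefined"
| "lincomb [(\<alpha>, t)] = Scale \<alpha> t"
| "lincomb ((\<alpha>, t) # p # ps) = Plus (Scale \<alpha> t) (lincomb (p # ps))"

definition canonical ::
    "('x, 'a, 'c, 'f) strs \<Rightarrow> (('x, 'a, 'c, 'f) amp \<times> ('x, 'a, 'c, 'f) trm) list \<Rightarrow> bool" where
  "canonical R ps \<longleftrightarrow> ps \<noteq> [] \<and> distinct (map snd ps) \<and>
     (\<forall>(\<alpha>, t)\<in>set ps. is_amp R \<alpha> \<and> (\<exists>z. amp_denotes R \<alpha> z \<and> z \<noteq> 0) \<and> is_trm R t \<and> classical t)"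


section \<open>Rules\<close>

primrec var_occs :: "('x, 'a, 'c, 'f) trm \<Rightarrow> 'x list"
  and var_occs_amp :: "('x, 'a, 'c, 'f) amp \<Rightarrow> 'x list" where
  "var_occs (Var x) = [x]"
| "var_occs (App b ts) = concat (map var_occs ts)"
| "var_occs (Scale \<alpha> t) = var_occs_amp \<alpha> @ var_occs t"
| "var_occs (Plus s t) = var_occs s @ var_occs t"
| "var_occs_amp (Amp a ts) = concat (map var_occs ts)"
| "var_occs_amp (AMul \<alpha> \<beta>) = var_occs_amp \<alpha> @ var_occs_amp \<beta>"
| "var_occs_amp (AAdd \<alpha> \<beta>) = var_occs_amp \<alpha> @ var_occs_amp \<beta>"

definition left_linear :: "('x, 'a, 'c, 'f) trm \<times> ('x, 'a, 'c, 'f) trm \<Rightarrow> bool" where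
  "left_linear \<rho> \<longleftrightarrow> distinct (var_occs (fst \<rho>))"

fun subterms :: "('x, 'a, 'c, 'f) trm \<Rightarrow> ('x, 'a, 'c, 'f) trm set" where
  "subterms (Var x) = {Var x}"
| "subterms (App b ts) = insert (App b ts) (\<Union>t\<in>set ts. subterms t)"
| "subterms (Scale \<alpha> t) = insert (Scale \<alpha> t) (subterms t)"
| "subterms (Plus s t) = insert (Plus s t) (subterms s \<union> subterms t)"

text \<open>
  Using two independent maps \<open>\<sigma>\<close> and \<open>\<tau>\<close> renders unifiability after renaming apart.
\<close>

definition unifiable_apart ::
    "('x, 'a, 'c, 'f) strs \<Rightarrow> ('x, 'a, 'c, 'f) trm \<Rightarrow> ('x, 'a, 'c, 'f) trm \<Rightarrow> bool" where
  "unifiable_apart R s t \<longleftrightarrow>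
     (\<exists>\<sigma> \<tau>. (\<forall>x. is_trm R (\<sigma> x)) \<and> (\<forall>x. is_trm R (\<tau> x)) \<and> subst_trm \<sigma> s = subst_trm \<tau> t)"

text \<open>
  The only overlap permitted is the trivial one of a rule with itself at the root.
\<close>

definition non_overlapping ::
    "('x, 'a, 'c, 'f) strs \<Rightarrow> (('x, 'a, 'c, 'f) trm \<times> ('x, 'a, 'c, 'f) trm) set \<Rightarrow> bool" where
  "non_overlapping R P \<longleftrightarrow>
     (\<forall>\<rho>\<in>P. \<forall>\<rho>'\<in>P. \<forall>u\<in>subterms (fst \<rho>).
        u \<notin> range Var \<and> unifiable_apart R u (fst \<rho>') \<longrightarrow> \<rho> = \<rho>' \<and> u = fst \<rho>)"

definition is_rule ::
    "('x, 'a, 'c, 'f) strs \<Rightarrow> ('x, 'a, 'c, 'f) trm \<times> ('x, 'a, 'c, 'f) trm \<Rightarrow> bool" where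
  "is_rule R = (\<lambda>(l, r).
     (\<exists>f ps. l = Fun f ps \<and> length ps = fun_ar R f \<and>
        (\<forall>p\<in>set ps. is_trm R p \<and> classical p \<and> funs_trm p = {})) \<and>
     is_trm R r \<and> vars_trm r \<subseteq> vars_trm l)"

text \<open>
  The last conjunct is what is needed of the constant amplitudes denoting given scalars: \<open>-1\<close> must be
  expressible by some ground amplitude (a constant symbol denoting \<open>-1\<close> is one).  It makes any two
  amplitudes of the same value interchangeable up to \<open>eqv\<close>.  Without it, for instance
  \<open>Scale (AMul \<alpha> \<beta>) t\<close> and \<open>Scale (AMul \<beta> \<alpha>) t\<close> need not be related, and with a rule erasing the
  arguments of a binary function symbol one gets a term reducing to both of them, which refutes
  confluence modulo \<open>eqv\<close>.
\<close>

definition is_strs :: "('x, 'a, 'c, 'f) strs \<Rightarrow> bool" where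
  "is_strs R \<longleftrightarrow>
     distinct [unit_con R, ket0_con R, ket1_con R, zero_con R, suc_con R, pair_con R,
               nil_con R, cons_con R] \<and>
     con_ar R (unit_con R) = 0 \<and> con_ar R (ket0_con R) = 0 \<and> con_ar R (ket1_con R) = 0 \<and>
     con_ar R (zero_con R) = 0 \<and> con_ar R (suc_con R) = 1 \<and> con_ar R (pair_con R) = 2 \<and>
     con_ar R (nil_con R) = 0 \<and> con_ar R (cons_con R) = 2 \<and>
     (\<forall>\<rho>\<in>rules R. is_rule R \<rho> \<and> left_linear \<rho>) \<and> non_overlapping R (rules R) \<and>
     (\<exists>\<alpha>. is_amp R \<alpha> \<and> vars_amp \<alpha> = {} \<and> amp_val R \<alpha> = - 1)"


section \<open>Reduction\<close>

datatype ('x, 'a, 'c, 'f) ectx =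
    Hole
  | CApp "'c + 'f" "('x, 'a, 'c, 'f) trm list" "('x, 'a, 'c, 'f) ectx" "('x, 'a, 'c, 'f) trm list"

primrec plug :: "('x, 'a, 'c, 'f) ectx \<Rightarrow> ('x, 'a, 'c, 'f) trm \<Rightarrow> ('x, 'a, 'c, 'f) trm" where
  "plug Hole t = t"
| "plug (CApp b vs E ts) t = App b (vs @ plug E t # ts)"

primrec is_ectx :: "('x, 'a, 'c, 'f) strs \<Rightarrow> ('x, 'a, 'c, 'f) ectx \<Rightarrow> bool" where
  "is_ectx R Hole = True"
| "is_ectx R (CApp b vs E ts) = ((\<forall>v\<in>set vs. is_value R v) \<and> is_ectx R E)"

text \<open>
  In rule \<open>Q\<close> the reduction relation also occurs negatively, through the normal forms.  It is
  therefore defined inductively relative to a set \<open>N\<close> playing the role of the normal forms, and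
  then tied to its own set of normal forms by a fixpoint equation, whose solution is unique
  (\<open>red_unfold\<close> and \<open>red_unique\<close> below).
\<close>

inductive step ::
    "('x, 'a, 'c, 'f) strs \<Rightarrow> ('x, 'a, 'c, 'f) trm set \<Rightarrow>
     ('x, 'a, 'c, 'f) trm \<Rightarrow> ('x, 'a, 'c, 'f) trm \<Rightarrow> bool" for R N where
  C: "(l, r) \<in> rules R \<Longrightarrow> is_subst R \<sigma> \<Longrightarrow> is_ectx R E \<Longrightarrow> classical (plug E (subst_trm \<sigma> l)) \<Longrightarrow>
    plug E (subst_trm \<sigma> l) \<in> ground_trms R \<Longrightarrow> plug E (subst_trm \<sigma> r) \<in> ground_trms R \<Longrightarrow>
    step R N (plug E (subst_trm \<sigma> l)) (plug E (subst_trm \<sigma> r))"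
| E: "eqv R s s' \<Longrightarrow> step R N s' t' \<Longrightarrow> eqv R t' t \<Longrightarrow>
    s \<in> ground_trms R \<Longrightarrow> t \<in> ground_trms R \<Longrightarrow> step R N s t"
| Q: "length \<alpha>s = length ss \<Longrightarrow> length ts = length ss \<Longrightarrow> canonical R (zip \<alpha>s ss) \<Longrightarrow>
    \<forall>i<length ss. ss ! i \<in> N \<and> ts ! i = ss ! i \<or> step R N (ss ! i) (ts ! i) \<Longrightarrow>
    \<exists>i<length ss. step R N (ss ! i) (ts ! i) \<Longrightarrow>
    lincomb (zip \<alpha>s ss) \<in> ground_trms R \<Longrightarrow> lincomb (zip \<alpha>s ts) \<in> ground_trms R \<Longrightarrow>
    step R N (lincomb (zip \<alpha>s ss)) (lincomb (zip \<alpha>s ts))"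

definition nfs ::
    "('x, 'a, 'c, 'f) strs \<Rightarrow> (('x, 'a, 'c, 'f) trm \<Rightarrow> ('x, 'a, 'c, 'f) trm \<Rightarrow> bool) \<Rightarrow>
     ('x, 'a, 'c, 'f) trm set" where
  "nfs R S = {s \<in> ground_trms R. \<nexists>t. S s t}"

definition red ::
    "('x, 'a, 'c, 'f) strs \<Rightarrow> ('x, 'a, 'c, 'f) trm \<Rightarrow> ('x, 'a, 'c, 'f) trm \<Rightarrow> bool" where
  "red R = (THE S. S = step R (nfs R S))"


section \<open>The reduction relation is well defined\<close>

definition amp0 :: "('x, 'a, 'c, 'f) strs \<Rightarrow> ('x, 'a, 'c, 'f) amp \<Rightarrow> complex" where
  "amp0 R \<alpha> = amp_val R (subst_amp (\<lambda>_. Con (zero_con R) [] :: ('x, 'a, 'c, 'f) trm) \<alpha>)"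

text \<open>
  \<open>coef R t k\<close> is the coefficient of the classical term \<open>k\<close> in the linear combination denoted by
  \<open>t\<close> (with variables inside amplitudes read as zero).
\<close>

primrec coef ::
    "('x, 'a, 'c, 'f) strs \<Rightarrow> ('x, 'a, 'c, 'f) trm \<Rightarrow> ('x, 'a, 'c, 'f) trm \<Rightarrow> complex" where
  "coef R (Var x) = (\<lambda>k. if k = Var x then 1 else 0)"
| "coef R (App b ts) = (\<lambda>k. case k of
      App b' ks \<Rightarrow> if b' = b \<and> length ks = length ts
        then prod_list (map2 (\<lambda>g k. g k) (map (coef R) ts) ks) else 0
    | _ \<Rightarrow> 0)"
| "coef R (Scale \<alpha> t) = (\<lambda>k. amp0 R \<alpha> * coef R t k)"
| "coef R (Plus s t) = (\<lambda>k. coef R s k + coef R t k)"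


lemma is_value_zero: "is_strs R \<Longrightarrow> is_value R (Con (zero_con R) [])"
  by (rule is_value.intros) (auto simp: is_strs_def)

lemma is_natural_subst_zero:
  "is_natural R n \<Longrightarrow>
     is_natural R (subst_trm (\<lambda>_. Con (zero_con R) [] :: ('x, 'a, 'c, 'f) trm) n) \<and>
     vars_trm (subst_trm (\<lambda>_. Con (zero_con R) [] :: ('x, 'a, 'c, 'f) trm) n) = {}"
  for R :: "('x, 'a, 'c, 'f) strs"
  by (induction rule: is_natural.induct) (auto intro: is_natural.intros)

lemma is_amp_subst_zero:
  "is_amp R \<alpha> \<Longrightarrow>
     is_amp R (subst_amp (\<lambda>_. Con (zero_con R) [] :: ('x, 'a, 'c, 'f) trm) \<alpha>) \<and>
     vars_amp (subst_amp (\<lambda>_. Con (zero_con R) [] :: ('x, 'a, 'c, 'f) trm) \<alpha>) = {}"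
  for R :: "('x, 'a, 'c, 'f) strs"
  by (induction rule: is_amp.induct)
     (auto intro!: is_amp.intros simp: is_natural_subst_zero)

lemma amp0_denotes:
  assumes "is_strs R" "is_amp R \<alpha>" "amp_denotes R \<alpha> z"
  shows "amp0 R \<alpha> = z"
proof -
  have "is_subst R (\<lambda>_. Con (zero_con R) [])"
    using is_value_zero[OF assms(1)] by (simp add: is_subst_def)
  then show ?thesis
    using assms(3) is_amp_subst_zero[OF assms(2)] unfolding amp_denotes_def amp0_def by blast
qed

lemma prod_map2_split:
  fixes x :: "'k \<Rightarrow> complex"
  assumes "length ks = Suc (length gs + length hs)"
  shows "prod_list (map2 (\<lambda>g k. g k) (gs @ x # hs) ks) =
    prod_list (map2 (\<lambda>g k. g k) gs (take (length gs) ks)) * x (ks ! length gs) *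
    prod_list (map2 (\<lambda>g k. g k) hs (drop (Suc (length gs)) ks))"
proof -
  have ks: "ks = take (length gs) ks @ ks ! length gs # drop (Suc (length gs)) ks"
    using assms by (simp add: id_take_nth_drop)
  have "length (take (length gs) ks) = length gs" using assms by simp
  then show ?thesis by (subst ks) (simp add: mult.assoc del: append_take_drop_id)
qed

lemma coef_App_split:
  obtains A where
    "\<And>t. coef R (App b (us @ t # ws)) k = (case A of None \<Rightarrow> 0 | Some (k', z) \<Rightarrow> z * coef R t k')"
proof (cases "\<exists>ks. k = App b ks \<and> length ks = Suc (length us + length ws)")
  case True
  then obtain ks where ks: "k = App b ks" "length ks = Suc (length us + length ws)" by blast
  have "coef R (App b (us @ t # ws)) k =
      (prod_list (map2 (\<lambda>g k. g k) (map (coef R) us) (take (length us) ks)) *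
       prod_list (map2 (\<lambda>g k. g k) (map (coef R) ws) (drop (Suc (length us)) ks))) *
      coef R t (ks ! length us)" for t
    using ks prod_map2_split[of ks "map (coef R) us" "map (coef R) ws" "coef R t"] by simp
  then show ?thesis by (intro that[of "Some (_, _)"]) (auto simp del: coef.simps)
next
  case False
  have "coef R (App b (us @ t # ws)) k = 0" for t
    using False by (cases k) auto
  then show ?thesis by (intro that[of None]) (auto simp del: coef.simps)
qed

lemma coef_eqv:
  assumes "is_strs R"
  shows "eqv R s t \<Longrightarrow> coef R s k = coef R t k"
proof (induction arbitrary: k rule: eqv.induct)
  case (cong_App s t b us ws)
  show ?case
    by (rule coef_App_split[of R b us ws k])
       (simp add: cong_App.IH del: coef.simps split: option.split prod.split)
next
  case (zero s \<alpha> t)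
  then show ?case
    using amp0_denotes[OF assms, of \<alpha> 0] by (auto elim!: is_trm.cases[of R "Plus _ _"] is_trm.cases[of R "Scale _ _"])
next
  case (one \<alpha> t)
  then show ?case
    using amp0_denotes[OF assms, of \<alpha> 1] by (auto elim!: is_trm.cases[of R "Scale _ _"])
next
  case (lin_Scale b us \<alpha> t ws)
  show ?case
    by (rule coef_App_split[of R b us ws k])
       (simp add: coef.simps(3) del: coef.simps(2) split: option.split prod.split)
next
  case (lin_Plus b us s t ws)
  show ?case
    by (rule coef_App_split[of R b us ws k])
       (simp add: distrib_left coef.simps(4) del: coef.simps(2) split: option.split prod.split)
qed (auto simp: amp0_def algebra_simps simp del: coef.simps(2))

lemma coef_classical: "classical s \<Longrightarrow> coef R s k = (if k = s then 1 else 0)"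
proof (induction s arbitrary: k rule: classical.induct)
  case (2 b ts)
  have "prod_list (map2 (\<lambda>g k. g k) (map (coef R) us) ks) = (if ks = us then 1 else 0)"
    if "length ks = length us" "set us \<subseteq> set ts" for ks us
    using that by (induction ks us rule: list_induct2) (use 2 in auto)
  then show ?case by (cases k) auto
qed auto

lemma canonical_Cons: "canonical R (p # q # ps) \<Longrightarrow> canonical R (q # ps)"
  by (auto simp: canonical_def)

lemma coef_lincomb_notin:
  "canonical R ps \<Longrightarrow> k \<notin> snd ` set ps \<Longrightarrow> coef R (lincomb ps) k = 0"
  by (induction ps rule: lincomb.induct)
     (auto simp: canonical_def coef_classical)

lemma coef_lincomb_in:
  "canonical R ps \<Longrightarrow> (\<alpha>, k) \<in> set ps \<Longrightarrow> coef R (lincomb ps) k = amp0 R \<alpha>"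
proof (induction ps rule: lincomb.induct)
  case (3 \<beta> t p ps)
  have can: "canonical R (p # ps)" using canonical_Cons[OF 3(2)] .
  have t: "classical t" "t \<notin> snd ` set (p # ps)" using 3(2) by (auto simp: canonical_def)
  show ?case
  proof (cases "(\<alpha>, k) \<in> set (p # ps)")
    case True
    then have "k \<noteq> t" using t(2) by force
    then show ?thesis using 3(1)[OF can True] t(1) by (simp add: coef_classical)
  next
    case False
    then have "\<alpha> = \<beta>" "k = t" using 3(3) by auto
    then show ?thesis using coef_lincomb_notin[OF can t(2)] t(1) by (simp add: coef_classical)
  qed
qed (auto simp: canonical_def coef_classical)

lemma canonical_eqv_classical:
  assumes "is_strs R" "canonical R (zip \<alpha>s ss)" "length \<alpha>s = length ss" "classical s"
    and "eqv R (lincomb (zip \<alpha>s ss)) s" "i < length ss"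
  shows "ss ! i = s"
proof -
  have mem: "(\<alpha>s ! i, ss ! i) \<in> set (zip \<alpha>s ss)"
    using assms(3,6) by (auto simp: set_zip)
  then obtain z where "is_amp R (\<alpha>s ! i)" "amp_denotes R (\<alpha>s ! i) z" "z \<noteq> 0"
    using assms(2) unfolding canonical_def by blast
  then have "amp0 R (\<alpha>s ! i) \<noteq> 0" using amp0_denotes[OF assms(1)] by blast
  then have "coef R s (ss ! i) \<noteq> 0"
    using coef_lincomb_in[OF assms(2) mem] coef_eqv[OF assms(1,5), of "ss ! i"] by simp
  then show ?thesis using coef_classical[OF assms(4), of R "ss ! i"] by (auto split: if_splits)
qed

lemma eqv_classical_eq:
  assumes "is_strs R" "eqv R s t" "classical s" "classical t"
  shows "s = t"
  using coef_eqv[OF assms(1,2), of s] assms(3,4) by (auto simp: coef_classical split: if_splits)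

text \<open>
  Reducibility of classical terms does not depend on \<open>N\<close>, and \<open>N\<close> matters only for those.
\<close>

lemma step_classical:
  assumes "is_strs R"
  shows "step R N s t \<Longrightarrow> eqv R s s0 \<Longrightarrow> classical s0 \<Longrightarrow> \<exists>t0. step R N' s0 t0"
proof (induction rule: step.induct)
  case (C l r \<sigma> E)
  then show ?case using eqv_classical_eq[OF assms] by (metis step.C)
next
  case (E s s' t' t)
  then show ?case by (meson eqv.sym eqv.trans)
next
  case (Q \<alpha>s ss ts)
  then obtain i where i: "i < length ss" "eqv R (ss ! i) s0 \<Longrightarrow> \<exists>t0. step R N' s0 t0" by blast
  have eq: "ss ! i = s0"
    using canonical_eqv_classical[OF assms Q.hyps(3,1) _ _ i(1)] Q.prems by blast
  have "(\<alpha>s ! i, ss ! i) \<in> set (zip \<alpha>s ss)"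
    using Q.hyps(1) i(1) by (auto simp: set_zip)
  then have "is_trm R s0" using Q.hyps(3) eq by (force simp: canonical_def)
  then show ?case using i(2) eq eqv.refl by metis
qed

lemma step_mono:
  "step R N s t \<Longrightarrow> N \<inter> Collect classical \<subseteq> N' \<Longrightarrow> step R N' s t"
proof (induction rule: step.induct)
  case (Q \<alpha>s ss ts)
  have "classical (ss ! i)" if "i < length ss" for i
  proof -
    have "(\<alpha>s ! i, ss ! i) \<in> set (zip \<alpha>s ss)"
      using Q.hyps(1) that by (auto simp: set_zip)
    then show ?thesis using Q.hyps(3) by (force simp: canonical_def)
  qed
  then show ?case using Q by (intro step.Q) blast+
qed (blast intro: step.C step.E)+

lemma step_nfs_indep:
  assumes "is_strs R"
  shows "step R (nfs R (step R N)) = step R (nfs R (step R N'))"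
proof -
  have sub: "nfs R (step R M) \<inter> Collect classical \<subseteq> nfs R (step R M')" for M M'
  proof
    fix s assume s: "s \<in> nfs R (step R M) \<inter> Collect classical"
    then have "eqv R s s" by (auto simp: nfs_def ground_trms_def intro: eqv.refl)
    then show "s \<in> nfs R (step R M')"
      using s step_classical[OF assms, of M' s _ s M] by (auto simp: nfs_def)
  qed
  show ?thesis
    by (intro ext iffI) (erule step_mono[OF _ sub])+
qed

theorem red_ex1: "is_strs R \<Longrightarrow> \<exists>!S. S = step R (nfs R S)"
  by (metis step_nfs_indep)

theorem red_unfold: "is_strs R \<Longrightarrow> red R = step R (nfs R (red R))"
  using theI'[OF red_ex1] unfolding red_def .

theorem red_unique: "is_strs R \<Longrightarrow> S = step R (nfs R S) \<Longrightarrow> S = red R"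
  using red_ex1 red_unfold by blast

end

theory Submission
  imports Defs
begin

text \<open>
  A ground term denotes a vector of coefficients over the classical terms (\<open>coef\<close>), and because
  \<open>-1\<close> is expressible, \<open>eqv\<close> on ground terms is exactly equality of these vectors.  Left-to-right
  evaluation contexts and orthogonality leave a classical term at most one contraction, so a
  reduction step acts on vectors as the linear extension of a function on classical terms.  Hence
  reduction is deterministic modulo \<open>eqv\<close>, and of two reductions from the same term one is, modulo
  \<open>eqv\<close>, an initial segment of the other.
\<close>

section \<open>Ground amplitudes\<close>

definition ground_amp :: "('x, 'a, 'c, 'f) strs \<Rightarrow> ('x, 'a, 'c, 'f) amp \<Rightarrow> bool" where
  "ground_amp R \<alpha> \<longleftrightarrow> is_amp R \<alpha> \<and> vars_amp \<alpha> = {}"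

lemma ground_ampD: "ground_amp R \<alpha> \<Longrightarrow> is_amp R \<alpha>"
  by (simp add: ground_amp_def)

lemma ground_amp_AMul: "ground_amp R \<alpha> \<Longrightarrow> ground_amp R \<beta> \<Longrightarrow> ground_amp R (AMul \<alpha> \<beta>)"
  by (simp add: ground_amp_def is_amp.intros)

lemma ground_amp_AAdd: "ground_amp R \<alpha> \<Longrightarrow> ground_amp R \<beta> \<Longrightarrow> ground_amp R (AAdd \<alpha> \<beta>)"
  by (simp add: ground_amp_def is_amp.intros)

lemma subst_ground:
  shows "vars_trm t = {} \<Longrightarrow> subst_trm \<sigma> t = t"
    and "vars_amp \<alpha> = {} \<Longrightarrow> subst_amp \<sigma> \<alpha> = \<alpha>"
  by (induction t and \<alpha>) (auto intro: map_idI)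

lemma ground_amp_denotes: "ground_amp R \<alpha> \<Longrightarrow> amp_denotes R \<alpha> (amp_val R \<alpha>)"
  by (auto simp: ground_amp_def amp_denotes_def subst_ground)

lemma amp0_ground: "ground_amp R \<alpha> \<Longrightarrow> amp0 R \<alpha> = amp_val R \<alpha>"
  by (simp add: ground_amp_def amp0_def subst_ground)


section \<open>Completeness of the equivalence\<close>

inductive_cases is_trm_App: "is_trm R (App b ts)"
inductive_cases is_trm_Scale: "is_trm R (Scale \<alpha> t)"
inductive_cases is_trm_Plus: "is_trm R (Plus s t)"

lemma is_trm_App_iff [simp]: "is_trm R (App b ts) \<longleftrightarrow> length ts = sym_ar R b \<and> (\<forall>t\<in>set ts. is_trm R t)"
  by (auto elim: is_trm_App intro: is_trm.intros)

lemma is_trm_Scale_iff [simp]: "is_trm R (Scale \<alpha> t) \<longleftrightarrow> is_amp R \<alpha> \<and> is_trm R t"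
  by (auto elim: is_trm_Scale intro: is_trm.intros)

lemma is_trm_Plus_iff [simp]: "is_trm R (Plus s t) \<longleftrightarrow> is_trm R s \<and> is_trm R t"
  by (auto elim: is_trm_Plus intro: is_trm.intros)

lemma eqv_is_trm: "eqv R s t \<Longrightarrow> is_trm R s \<and> is_trm R t"
  by (induction rule: eqv.induct) (auto intro: is_amp.intros)

lemmas [trans] = eqv.trans

lemma eqv_Plus:
  assumes "eqv R s s'" "eqv R t t'"
  shows "eqv R (Plus s t) (Plus s' t')"
  using assms eqv.cong_Plus1 eqv.cong_Plus2 eqv.trans eqv_is_trm by metis

text \<open>Exchanging the two inner summands is what lets \<open>eqv_Plus_combination\<close> add
  two sums summand by summand.\<close>

lemma eqv_Plus_swap:
  assumes "is_trm R s" "is_trm R t" "is_trm R u" "is_trm R v"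
  shows "eqv R (Plus (Plus s t) (Plus u v)) (Plus (Plus s u) (Plus t v))"
proof -
  \<comment> \<open>Once both inner summands share a bracket, commutativity can swap them; the same
    fact with \<open>t\<close> and \<open>u\<close> exchanged then restores the bracketing.\<close>
  have *: "eqv R (Plus (Plus s x) (Plus y v)) (Plus s (Plus (Plus x y) v))"
    if "is_trm R x" "is_trm R y" for x y
  proof -
    have "eqv R (Plus (Plus s x) (Plus y v)) (Plus s (Plus x (Plus y v)))"
      using assms that by (intro eqv.sym[OF eqv.assoc]) simp
    also have "eqv R \<dots> (Plus s (Plus (Plus x y) v))"
      using assms that by (intro eqv.cong_Plus2 eqv.assoc) simp_all
    finally show ?thesis .
  qed
  have "eqv R (Plus s (Plus (Plus t u) v)) (Plus s (Plus (Plus u t) v))"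
    using assms by (intro eqv.cong_Plus2 eqv.cong_Plus1 eqv.comm) simp_all
  then show ?thesis using *[of t u] *[of u t] assms eqv.trans eqv.sym by meson
qed

text \<open>
  No rule of \<open>eqv\<close> compares amplitudes other than 0 and 1, so \<open>\<beta>\<close> is brought in through
  \<open>\<alpha> \<cdot> t \<equiv> \<alpha> \<cdot> t + (-\<beta> + \<beta>) \<cdot> t \<equiv> (\<alpha> + -\<beta>) \<cdot> t + \<beta> \<cdot> t\<close>.
\<close>

lemma eqv_Scale_cong_val:
  assumes "is_strs R" and \<alpha>: "ground_amp R \<alpha>" and \<beta>: "ground_amp R \<beta>"
    and "amp_val R \<alpha> = amp_val R \<beta>" and "is_trm R t"
  shows "eqv R (Scale \<alpha> t) (Scale \<beta> t)"
proof -
  obtain m where m: "ground_amp R m" "amp_val R m = -1"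
    using assms(1) by (auto simp: is_strs_def ground_amp_def)
  let ?\<gamma> = "AMul m \<beta>"
  have \<gamma>: "ground_amp R ?\<gamma>" using m(1) \<beta> by (rule ground_amp_AMul)
  have z1: "amp_denotes R (AAdd ?\<gamma> \<beta>) 0"
    using ground_amp_denotes[OF ground_amp_AAdd[OF \<gamma> \<beta>]] m(2) by simp
  have z2: "amp_denotes R (AAdd \<alpha> ?\<gamma>) 0"
    using ground_amp_denotes[OF ground_amp_AAdd[OF \<alpha> \<gamma>]] m(2) assms(4) by simp
  note amps = ground_ampD[OF \<alpha>] ground_ampD[OF \<beta>] ground_ampD[OF \<gamma>] assms(5)
  have "eqv R (Scale \<alpha> t) (Plus (Scale \<alpha> t) (Scale (AAdd ?\<gamma> \<beta>) t))"
    using amps z1 by (intro eqv.sym[OF eqv.zero]) (simp_all add: is_amp.intros)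
  also have "eqv R \<dots> (Plus (Scale \<alpha> t) (Plus (Scale ?\<gamma> t) (Scale \<beta> t)))"
    using amps by (intro eqv.cong_Plus2 eqv.sym[OF eqv.factor]) simp_all
  also have "eqv R \<dots> (Plus (Plus (Scale \<alpha> t) (Scale ?\<gamma> t)) (Scale \<beta> t))"
    using amps by (intro eqv.assoc) simp
  also have "eqv R \<dots> (Plus (Scale (AAdd \<alpha> ?\<gamma>) t) (Scale \<beta> t))"
    using amps by (intro eqv.cong_Plus1 eqv.factor) simp_all
  also have "eqv R \<dots> (Plus (Scale \<beta> t) (Scale (AAdd \<alpha> ?\<gamma>) t))"
    using amps by (intro eqv.comm) (simp add: is_amp.intros)
  also have "eqv R \<dots> (Scale \<beta> t)"
    using amps z2 by (intro eqv.zero) (simp_all add: is_amp.intros)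
  finally show ?thesis .
qed

section \<open>Ground terms as linear combinations of classical terms\<close>

text \<open>The rule \<open>eqv\<close> closes the class backwards under equivalence, so a single
  induction principle covers all terms equivalent to a combination of classical terms with ground
  amplitudes.\<close>

inductive linear_trm :: "('x, 'a, 'c, 'f) strs \<Rightarrow> ('x, 'a, 'c, 'f) trm \<Rightarrow> bool" for R where
  classical: "is_trm R t \<Longrightarrow> classical t \<Longrightarrow> linear_trm R t"
| Scale: "ground_amp R \<alpha> \<Longrightarrow> linear_trm R t \<Longrightarrow> linear_trm R (Scale \<alpha> t)"
| Plus: "linear_trm R s \<Longrightarrow> linear_trm R t \<Longrightarrow> linear_trm R (Plus s t)"
| eqv: "eqv R s t \<Longrightarrow> linear_trm R t \<Longrightarrow> linear_trm R s"

lemma linear_trm_is_trm: "linear_trm R t \<Longrightarrow> is_trm R t"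
  by (induction rule: linear_trm.induct) (auto simp: ground_ampD eqv_is_trm)

text \<open>Arguments are treated from left to right, and \<open>us\<close> collects those already
  classical. Induction on the derivation for the next argument pulls its sums and amplitudes out of
  the symbol by \<open>eqv.lin_Plus\<close> and \<open>eqv.lin_Scale\<close>; once classical, it
  joins \<open>us\<close> and the outer induction takes over.\<close>

lemma linear_trm_App:
  assumes "\<forall>t\<in>set ts. linear_trm R t" "\<forall>u\<in>set us. is_trm R u \<and> classical u"
    and "length us + length ts = sym_ar R b"
  shows "linear_trm R (App b (us @ ts))"
  using assms
proof (induction ts arbitrary: us)
  case Nil
  then show ?case by (intro linear_trm.classical) auto
next
  case (Cons t ts)
  have ts: "\<forall>t\<in>set ts. is_trm R t" using Cons.prems(1) linear_trm_is_trm by auto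
  have "linear_trm R t" using Cons.prems(1) by simp
  then show ?case
  proof (induction t rule: linear_trm.induct)
    case (classical t)
    then show ?case using Cons.IH[of "us @ [t]"] Cons.prems by simp
  next
    case (Scale \<alpha> t)
    have "eqv R (App b (us @ Scale \<alpha> t # ts)) (Scale \<alpha> (App b (us @ t # ts)))"
      using Scale Cons.prems ts by (intro eqv.lin_Scale) (auto simp: ground_ampD linear_trm_is_trm)
    then show ?case using Scale by (meson linear_trm.intros)
  next
    case (Plus s t)
    have "eqv R (App b (us @ Plus s t # ts)) (Plus (App b (us @ s # ts)) (App b (us @ t # ts)))"
      using Plus Cons.prems ts by (intro eqv.lin_Plus) (auto simp: linear_trm_is_trm)
    then show ?case using Plus by (meson linear_trm.intros)
  next
    case (eqv s t)
    have "eqv R (App b (us @ s # ts)) (App b (us @ t # ts))"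
      using eqv Cons.prems ts by (intro eqv.cong_App) (auto simp: eqv_is_trm)
    then show ?case using eqv by (meson linear_trm.intros)
  qed
qed

lemma linear_trm_ground: "is_trm R t \<Longrightarrow> vars_trm t = {} \<Longrightarrow> linear_trm R t"
proof (induction rule: is_trm.induct)
  case (2 ts b)
  then show ?case using linear_trm_App[of ts R "[]" b] by auto
qed (auto intro: linear_trm.intros simp: ground_amp_def)

section \<open>Arithmetic of combinations over a fixed list\<close>

text \<open>Amplitudes are a function of the term and may have value 0, so that combinations over
  one list add, scale and compare pointwise. Canonical forms, which exclude zero amplitudes, need
  not share a list.\<close>

abbreviation combination ::
    "(('x, 'a, 'c, 'f) trm \<Rightarrow> ('x, 'a, 'c, 'f) amp) \<Rightarrow> ('x, 'a, 'c, 'f) trm list \<Rightarrow>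
     ('x, 'a, 'c, 'f) trm" where
  "combination \<alpha> ks \<equiv> lincomb (map (\<lambda>k. (\<alpha> k, k)) ks)"

lemma is_trm_combination:
  "ks \<noteq> [] \<Longrightarrow> \<forall>k\<in>set ks. is_trm R k \<Longrightarrow> \<forall>k. ground_amp R (\<alpha> k) \<Longrightarrow> is_trm R (combination \<alpha> ks)"
  by (induction ks rule: induct_list012) (auto simp: ground_ampD)

lemma eqv_Plus_combination:
  assumes "ks \<noteq> []" "\<forall>k\<in>set ks. is_trm R k" "\<forall>k. ground_amp R (\<alpha> k)" "\<forall>k. ground_amp R (\<beta> k)"
  shows "eqv R (Plus (combination \<alpha> ks) (combination \<beta> ks)) (combination (\<lambda>k. AAdd (\<alpha> k) (\<beta> k)) ks)"
  using assms
proof (induction ks rule: induct_list012)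
  case (2 k)
  then show ?case by (auto intro!: eqv.factor simp: ground_ampD)
next
  case (3 k j ks)
  have "is_trm R (combination \<alpha> (j # ks))" "is_trm R (combination \<beta> (j # ks))"
    using 3(4-6) by (intro is_trm_combination; simp)+
  then have "eqv R (Plus (combination \<alpha> (k # j # ks)) (combination \<beta> (k # j # ks)))
      (Plus (Plus (Scale (\<alpha> k) k) (Scale (\<beta> k) k))
            (Plus (combination \<alpha> (j # ks)) (combination \<beta> (j # ks))))"
    using 3(4-6) by (auto intro!: eqv_Plus_swap simp: ground_ampD)
  also have "eqv R \<dots> (combination (\<lambda>k. AAdd (\<alpha> k) (\<beta> k)) (k # j # ks))"
    using 3 by (auto intro!: eqv_Plus eqv.factor simp: ground_ampD)
  finally show ?case .
qed simp

lemma eqv_Scale_combination: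
  assumes "ks \<noteq> []" "\<forall>k\<in>set ks. is_trm R k" "\<forall>k. ground_amp R (\<alpha> k)" "ground_amp R \<gamma>"
  shows "eqv R (Scale \<gamma> (combination \<alpha> ks)) (combination (\<lambda>k. AMul \<gamma> (\<alpha> k)) ks)"
  using assms
proof (induction ks rule: induct_list012)
  case (2 k)
  then show ?case by (auto intro!: eqv.mult simp: ground_ampD)
next
  case (3 k j ks)
  have "is_trm R (combination \<alpha> (j # ks))"
    using 3(4-6) by (intro is_trm_combination; simp)
  then have "eqv R (Scale \<gamma> (combination \<alpha> (k # j # ks)))
      (Plus (Scale \<gamma> (Scale (\<alpha> k) k)) (Scale \<gamma> (combination \<alpha> (j # ks))))"
    using 3(4-6) by (auto intro!: eqv.distrib simp: ground_ampD)
  also have "eqv R \<dots> (combination (\<lambda>k. AMul \<gamma> (\<alpha> k)) (k # j # ks))"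
    using 3 by (auto intro!: eqv_Plus eqv.mult simp: ground_ampD)
  finally show ?case .
qed simp

lemma eqv_combination_cong_val:
  assumes "is_strs R" "ks \<noteq> []" "\<forall>k\<in>set ks. is_trm R k"
    and "\<forall>k. ground_amp R (\<alpha> k)" "\<forall>k. ground_amp R (\<beta> k)"
    and "\<forall>k\<in>set ks. amp_val R (\<alpha> k) = amp_val R (\<beta> k)"
  shows "eqv R (combination \<alpha> ks) (combination \<beta> ks)"
  using assms(2-)
  by (induction ks rule: induct_list012)
     (auto intro!: eqv_Plus eqv_Scale_cong_val[OF assms(1)])

text \<open>There is no zero term, and \<open>eqv.zero\<close> deletes a vanishing summand only to
  the right of another term; \<open>s\<close> serves as that other term all along the list.\<close>

lemma eqv_Plus_zero_combination:
  assumes "ks \<noteq> []" "\<forall>k\<in>set ks. is_trm R k" "\<forall>k. ground_amp R (\<alpha> k)"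
    and "\<forall>k\<in>set ks. amp_val R (\<alpha> k) = 0" "is_trm R s"
  shows "eqv R (Plus s (combination \<alpha> ks)) s"
  using assms
proof (induction ks rule: induct_list012)
  case (2 k)
  then show ?case using ground_amp_denotes[of R "\<alpha> k"] by (auto intro!: eqv.zero simp: ground_ampD)
next
  case (3 k j ks)
  have "is_trm R (combination \<alpha> (j # ks))"
    using 3(4-6) by (intro is_trm_combination; simp)
  then have "eqv R (Plus s (combination \<alpha> (k # j # ks)))
      (Plus (Plus s (Scale (\<alpha> k) k)) (combination \<alpha> (j # ks)))"
    using 3(4-) by (auto intro!: eqv.assoc simp: ground_ampD)
  also have "eqv R \<dots> (Plus s (combination \<alpha> (j # ks)))"
    using 3(4-) \<open>is_trm R (combination \<alpha> (j # ks))\<close> ground_amp_denotes[of R "\<alpha> k"]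
    by (auto intro!: eqv.cong_Plus1 eqv.zero simp: ground_ampD)
  also have "eqv R \<dots> s" using 3 by simp
  finally show ?case .
qed simp

lemma eqv_unit_combination:
  assumes "\<forall>j\<in>set ks. is_trm R j" "\<forall>j. ground_amp R (\<alpha> j)" "distinct ks" "k \<in> set ks"
    and "\<forall>j. amp_val R (\<alpha> j) = (if j = k then 1 else 0)"
  shows "eqv R k (combination \<alpha> ks)"
proof -
  have one: "eqv R k (Scale (\<alpha> k) k)"
    using assms ground_amp_denotes[of R "\<alpha> k"] by (auto intro!: eqv.sym[OF eqv.one] simp: ground_ampD)
  show ?thesis
    using assms(1,3,4)
  proof (induction ks rule: induct_list012)
    case (2 j)
    then show ?case using one by simp
  next
    case (3 j i ks)
    have trm: "is_trm R (combination \<alpha> (i # ks))"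
      using 3(3) assms(2) by (intro is_trm_combination; simp)
    show ?case
    proof (cases "j = k")
      case True
      have "eqv R (Plus (Scale (\<alpha> k) k) (combination \<alpha> (i # ks))) (Scale (\<alpha> k) k)"
        using 3(3-) True assms(2,5)
        by (intro eqv_Plus_zero_combination) (auto simp: ground_ampD)
      then show ?thesis using True one eqv.sym eqv.trans by fastforce
    next
      case False
      \<comment> \<open>Now the head has amplitude value 0. \<open>eqv.zero\<close> can introduce it
        only on the right, and commutativity then brings it to the front.\<close>
      have "eqv R k (combination \<alpha> (i # ks))" using 3 False by simp
      also have "eqv R \<dots> (Plus (combination \<alpha> (i # ks)) (Scale (\<alpha> j) j))"
        using 3(3-) False trm assms(2,5) ground_amp_denotes[of R "\<alpha> j"]
        by (intro eqv.sym[OF eqv.zero]) (auto simp: ground_ampD)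
      also have "eqv R \<dots> (Plus (Scale (\<alpha> j) j) (combination \<alpha> (i # ks)))"
        using 3(3-) trm assms(2) by (intro eqv.comm) (auto simp: ground_ampD)
      finally show ?thesis by simp
    qed
  qed simp
qed

section \<open>Expansion over finite sets of classical terms\<close>

definition expands ::
    "('x, 'a, 'c, 'f) strs \<Rightarrow> ('x, 'a, 'c, 'f) trm \<Rightarrow> ('x, 'a, 'c, 'f) trm list \<Rightarrow> bool" where
  "expands R s ks \<longleftrightarrow> (\<exists>\<alpha>. (\<forall>k. ground_amp R (\<alpha> k)) \<and> eqv R s (combination \<alpha> ks))"

text \<open>Asking for an expansion over every duplicate-free list of terms that contains
  \<open>K\<close> builds in the enlargement of \<open>K\<close>, so that two terms can later be
  expanded over one common list. \<open>K\<close> is non-empty because \<open>lincomb []\<close> is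
  unspecified.\<close>

definition spanned_by ::
    "('x, 'a, 'c, 'f) strs \<Rightarrow> ('x, 'a, 'c, 'f) trm set \<Rightarrow> ('x, 'a, 'c, 'f) trm \<Rightarrow> bool" where
  "spanned_by R K s \<longleftrightarrow>
     finite K \<and> K \<noteq> {} \<and> (\<forall>k\<in>K. is_trm R k \<and> classical k) \<and>
     (\<forall>ks. K \<subseteq> set ks \<longrightarrow> distinct ks \<longrightarrow> (\<forall>k\<in>set ks. is_trm R k) \<longrightarrow> expands R s ks)"

lemma expands_Scale:
  assumes "expands R t ks" "ks \<noteq> []" "\<forall>k\<in>set ks. is_trm R k" "ground_amp R \<gamma>"
  shows "expands R (Scale \<gamma> t) ks"
proof -
  obtain \<alpha> where \<alpha>: "\<forall>k. ground_amp R (\<alpha> k)" "eqv R t (combination \<alpha> ks)"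
    using assms(1) by (auto simp: expands_def)
  have "eqv R (Scale \<gamma> t) (Scale \<gamma> (combination \<alpha> ks))"
    using \<alpha>(2) assms(4) by (simp add: eqv.cong_Scale ground_ampD)
  also have "eqv R \<dots> (combination (\<lambda>k. AMul \<gamma> (\<alpha> k)) ks)"
    using assms(2-4) \<alpha>(1) by (intro eqv_Scale_combination)
  finally have "eqv R (Scale \<gamma> t) (combination (\<lambda>k. AMul \<gamma> (\<alpha> k)) ks)" .
  moreover have "\<forall>k. ground_amp R (AMul \<gamma> (\<alpha> k))"
    using \<alpha>(1) assms(4) by (simp add: ground_amp_AMul)
  ultimately show ?thesis
    unfolding expands_def by (intro exI[of _ "\<lambda>k. AMul \<gamma> (\<alpha> k)"] conjI)
qed

lemma expands_Plus:
  assumes "expands R s ks" "expands R t ks" "ks \<noteq> []" "\<forall>k\<in>set ks. is_trm R k"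
  shows "expands R (Plus s t) ks"
proof -
  obtain \<alpha> where \<alpha>: "\<forall>k. ground_amp R (\<alpha> k)" "eqv R s (combination \<alpha> ks)"
    using assms(1) by (auto simp: expands_def)
  obtain \<beta> where \<beta>: "\<forall>k. ground_amp R (\<beta> k)" "eqv R t (combination \<beta> ks)"
    using assms(2) by (auto simp: expands_def)
  have "eqv R (Plus s t) (Plus (combination \<alpha> ks) (combination \<beta> ks))"
    using \<alpha>(2) \<beta>(2) by (rule eqv_Plus)
  also have "eqv R \<dots> (combination (\<lambda>k. AAdd (\<alpha> k) (\<beta> k)) ks)"
    using assms(3,4) \<alpha>(1) \<beta>(1) by (intro eqv_Plus_combination)
  finally have "eqv R (Plus s t) (combination (\<lambda>k. AAdd (\<alpha> k) (\<beta> k)) ks)" .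
  moreover have "\<forall>k. ground_amp R (AAdd (\<alpha> k) (\<beta> k))"
    using \<alpha>(1) \<beta>(1) by (simp add: ground_amp_AAdd)
  ultimately show ?thesis
    unfolding expands_def by (intro exI[of _ "\<lambda>k. AAdd (\<alpha> k) (\<beta> k)"] conjI)
qed

lemma spanned_by_classical:
  assumes "is_strs R" "is_trm R t" "classical t"
  shows "spanned_by R {t} t"
proof -
  obtain m where m: "ground_amp R m" "amp_val R m = -1"
    using assms(1) by (auto simp: is_strs_def ground_amp_def)
  \<comment> \<open>The amplitude \<open>m\<close> of value -1 supplies the values 1 and 0 as
    \<open>AMul m m\<close> and \<open>AAdd m (AMul m m)\<close>.\<close>
  let ?\<alpha> = "\<lambda>k. if k = t then AMul m m else AAdd m (AMul m m)"
  have "\<forall>k. ground_amp R (?\<alpha> k)" using m(1) by (simp add: ground_amp_AMul ground_amp_AAdd)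
  moreover have "eqv R t (combination ?\<alpha> ks)"
    if "{t} \<subseteq> set ks" "distinct ks" "\<forall>k\<in>set ks. is_trm R k" for ks
    using that m by (intro eqv_unit_combination) (auto simp: ground_amp_AMul ground_amp_AAdd)
  ultimately have "expands R t ks"
    if "{t} \<subseteq> set ks" "distinct ks" "\<forall>k\<in>set ks. is_trm R k" for ks
    unfolding expands_def using that by (intro exI[of _ ?\<alpha>] conjI)
  then show ?thesis using assms(2,3) by (simp add: spanned_by_def)
qed

lemma linear_trm_spanned:
  assumes "is_strs R" "linear_trm R s"
  shows "\<exists>K. spanned_by R K s"
  using assms(2)
proof (induction rule: linear_trm.induct)
  case (classical t)
  then show ?case using spanned_by_classical[OF assms(1)] by blast
next
  case (Scale \<gamma> t)
  then obtain K where "spanned_by R K t" by blast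
  then have "spanned_by R K (Scale \<gamma> t)"
    using Scale.hyps(1) unfolding spanned_by_def by (auto intro!: expands_Scale)
  then show ?case ..
next
  case (Plus s t)
  then obtain K J where "spanned_by R K s" "spanned_by R J t" by blast
  then have "spanned_by R (K \<union> J) (Plus s t)"
    unfolding spanned_by_def by (auto intro!: expands_Plus)
  then show ?case ..
next
  case (eqv s t)
  then obtain K where "spanned_by R K t" by blast
  moreover have "expands R s ks" if "expands R t ks" for ks
    using that eqv.trans[OF eqv.hyps(1)] by (auto simp: expands_def)
  ultimately have "spanned_by R K s" by (simp add: spanned_by_def)
  then show ?case ..
qed

section \<open>Coefficient vectors determine ground terms up to equivalence\<close>

lemma coef_lincomb:
  "ps \<noteq> [] \<Longrightarrow> coef R (lincomb ps) k = (\<Sum>(\<alpha>, t)\<leftarrow>ps. amp0 R \<alpha> * coef R t k)"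
  by (induction ps rule: lincomb.induct) auto

lemma coef_combination:
  assumes "\<forall>j\<in>set ks. classical j" "distinct ks" "k \<in> set ks"
  shows "coef R (combination \<alpha> ks) k = amp0 R (\<alpha> k)"
proof -
  have "coef R (combination \<alpha> ks) k = (\<Sum>j\<in>set ks. amp0 R (\<alpha> j) * coef R j k)"
    using assms by (subst coef_lincomb) (auto simp: o_def sum_list_distinct_conv_sum_set)
  also have "\<dots> = (\<Sum>j\<in>set ks. if k = j then amp0 R (\<alpha> j) else 0)"
    using assms(1) by (intro sum.cong) (auto simp: coef_classical)
  finally show ?thesis using assms(3) by simp
qed

text \<open>The converse of \<open>coef_eqv\<close> on ground terms. Over a common list of classical
  terms, the amplitude values of an expansion are the coefficients of the expanded term, so equal
  coefficients make the two expansions agree in value summand by summand.\<close>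

lemma eqv_if_coef_eq:
  assumes R: "is_strs R" and "s \<in> ground_trms R" "t \<in> ground_trms R" and "coef R s = coef R t"
  shows "eqv R s t"
proof -
  have "linear_trm R s" "linear_trm R t"
    using assms(2,3) by (auto simp: ground_trms_def linear_trm_ground)
  then obtain K J where KJ: "spanned_by R K s" "spanned_by R J t"
    using linear_trm_spanned[OF R] by blast
  then have "finite (K \<union> J)" "K \<noteq> {}" by (simp_all add: spanned_by_def)
  then obtain ks where ks: "set ks = K \<union> J" "distinct ks" "ks \<noteq> []"
    using finite_distinct_list[of "K \<union> J"] by fastforce
  have trms: "\<forall>k\<in>set ks. is_trm R k" and cl: "\<forall>k\<in>set ks. classical k"
    using ks(1) KJ by (auto simp: spanned_by_def)
  have "expands R s ks" "expands R t ks"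
    using KJ ks(1,2) trms by (auto simp: spanned_by_def)
  then obtain \<alpha> \<beta> where \<alpha>: "\<forall>k. ground_amp R (\<alpha> k)" "eqv R s (combination \<alpha> ks)"
    and \<beta>: "\<forall>k. ground_amp R (\<beta> k)" "eqv R t (combination \<beta> ks)"
    unfolding expands_def by (elim exE conjE)
  have "amp_val R (\<alpha> k) = amp_val R (\<beta> k)" if "k \<in> set ks" for k
  proof -
    have "amp_val R (\<alpha> k) = coef R s k"
      using coef_combination[OF cl ks(2) that, of R \<alpha>] \<alpha> coef_eqv[OF R \<alpha>(2), of k]
      by (simp add: amp0_ground)
    moreover have "amp_val R (\<beta> k) = coef R t k"
      using coef_combination[OF cl ks(2) that, of R \<beta>] \<beta> coef_eqv[OF R \<beta>(2), of k]
      by (simp add: amp0_ground)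
    ultimately show ?thesis using assms(4) by simp
  qed
  then have "eqv R (combination \<alpha> ks) (combination \<beta> ks)"
    using ks(3) trms \<alpha>(1) \<beta>(1) by (intro eqv_combination_cong_val[OF R]) auto
  then show ?thesis using \<alpha>(2) \<beta>(2) eqv.sym eqv.trans by meson
qed


section \<open>Determinism of contraction\<close>

text \<open>The contraction behind rule \<open>C\<close>, as a relation free of \<open>N\<close>;
  groundness and classicality are left to its uses.\<close>

definition contracts ::
    "('x, 'a, 'c, 'f) strs \<Rightarrow> ('x, 'a, 'c, 'f) trm \<Rightarrow> ('x, 'a, 'c, 'f) trm \<Rightarrow> bool" where
  "contracts R s t \<longleftrightarrow>
     (\<exists>l r \<sigma> E. (l, r) \<in> rules R \<and> is_subst R \<sigma> \<and> is_ectx R E \<and>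
        s = plug E (subst_trm \<sigma> l) \<and> t = plug E (subst_trm \<sigma> r))"

inductive_cases is_value_App: "is_value R (App b ts)"

lemma is_value_is_trm: "is_value R v \<Longrightarrow> is_trm R v"
  by (induction rule: is_value.induct) auto

text \<open>Patterns consist of constructors and variables, and variables receive values. Hence all
  arguments of a redex are values.\<close>

lemma is_value_pattern:
  assumes "is_subst R \<sigma>"
  shows "is_trm R p \<Longrightarrow> classical p \<Longrightarrow> funs_trm p = {} \<Longrightarrow> is_value R (subst_trm \<sigma> p)"
proof (induction rule: is_trm.induct)
  case (1 x)
  then show ?case using assms by (simp add: is_subst_def)
next
  case (2 ts b)
  then show ?case by (cases b) (auto intro!: is_value.intros)
qed auto

text \<open>A value headed by a symbol has a constructor at its head and values as arguments, so no
  function symbol is reached by descending through arguments.\<close>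

lemma not_is_value_plug_Fun: "\<not> is_value R (plug E (Fun f ts))"
  by (induction E) (auto elim: is_value_App)

lemma split_at_first_unique:
  assumes "xs @ x # ys = xs' @ x' # ys'" "\<forall>z\<in>set xs. P z" "\<forall>z\<in>set xs'. P z" "\<not> P x" "\<not> P x'"
  shows "xs = xs' \<and> x = x' \<and> ys = ys'"
  using assms
proof (induction xs arbitrary: xs')
  case Nil
  then show ?case by (cases xs') auto
next
  case (Cons a xs)
  then show ?case by (cases xs') auto
qed

text \<open>Left of the hole an evaluation context has only values, while the argument holding the
  redex is not a value; so at each level the hole sits at the first non-value. Since the arguments
  of a redex are values, neither redex lies strictly inside the other.\<close>

lemma plug_Fun_unique:
  assumes "is_ectx R E" "is_ectx R E'" "plug E (Fun f ts) = plug E' (Fun f' ts')"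
    and "\<forall>t\<in>set ts. is_value R t" "\<forall>t\<in>set ts'. is_value R t"
  shows "E = E' \<and> Fun f ts = Fun f' ts'"
  using assms
proof (induction E arbitrary: E')
  case Hole
  then show ?case using not_is_value_plug_Fun[of R] by (cases E') auto
next
  case (CApp b vs E us)
  show ?case
  proof (cases E')
    case Hole
    then show ?thesis using CApp.prems not_is_value_plug_Fun[of R] by auto
  next
    case (CApp b' vs' E'' us')
    then have "vs = vs' \<and> plug E (Fun f ts) = plug E'' (Fun f' ts') \<and> us = us'"
      using CApp.prems not_is_value_plug_Fun[of R]
      by (intro split_at_first_unique[where P = "is_value R"]) auto
    then show ?thesis using CApp.IH[of E''] CApp CApp.prems by auto
  qed
qed

lemma subst_eq_on_vars:
  shows "subst_trm \<sigma> t = subst_trm \<tau> t \<Longrightarrow> x \<in> vars_trm t \<Longrightarrow> \<sigma> x = \<tau> x"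
    and "subst_amp \<sigma> \<alpha> = subst_amp \<tau> \<alpha> \<Longrightarrow> x \<in> vars_amp \<alpha> \<Longrightarrow> \<sigma> x = \<tau> x"
  by (induction t and \<alpha>) auto

lemma subst_cong_on_vars:
  shows "(\<And>x. x \<in> vars_trm t \<Longrightarrow> \<sigma> x = \<tau> x) \<Longrightarrow> subst_trm \<sigma> t = subst_trm \<tau> t"
    and "(\<And>x. x \<in> vars_amp \<alpha> \<Longrightarrow> \<sigma> x = \<tau> x) \<Longrightarrow> subst_amp \<sigma> \<alpha> = subst_amp \<tau> \<alpha>"
  by (induction t and \<alpha>) auto

text \<open>By \<open>plug_Fun_unique\<close> both contractions act on the same redex. Non-overlap
  forces the same rule, and the substitutions agree on the variables of its left-hand side, which
  include those of its right-hand side.\<close>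

lemma contracts_unique:
  assumes R: "is_strs R" and "contracts R s t" "contracts R s t'"
  shows "t = t'"
proof -
  obtain l r \<sigma> E where 1: "(l, r) \<in> rules R" "is_subst R \<sigma>" "is_ectx R E"
    "s = plug E (subst_trm \<sigma> l)" "t = plug E (subst_trm \<sigma> r)"
    using assms(2) unfolding contracts_def by blast
  obtain l' r' \<tau> E' where 2: "(l', r') \<in> rules R" "is_subst R \<tau>" "is_ectx R E'"
    "s = plug E' (subst_trm \<tau> l')" "t' = plug E' (subst_trm \<tau> r')"
    using assms(3) unfolding contracts_def by blast
  have redex: "\<exists>f ts. subst_trm \<rho> l = Fun f ts \<and> (\<forall>t\<in>set ts. is_value R t)"
    "vars_trm r \<subseteq> vars_trm l" "l \<in> subterms l" "l \<notin> range Var"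
    if "(l, r) \<in> rules R" "is_subst R \<rho>" for l r \<rho>
  proof -
    have "is_rule R (l, r)" using R that(1) by (auto simp: is_strs_def)
    then show "\<exists>f ts. subst_trm \<rho> l = Fun f ts \<and> (\<forall>t\<in>set ts. is_value R t)"
      "vars_trm r \<subseteq> vars_trm l" "l \<in> subterms l" "l \<notin> range Var"
      by (auto simp: is_rule_def is_value_pattern[OF that(2)])
  qed
  obtain f ts f' ts' where "subst_trm \<sigma> l = Fun f ts" "\<forall>t\<in>set ts. is_value R t"
    "subst_trm \<tau> l' = Fun f' ts'" "\<forall>t\<in>set ts'. is_value R t"
    using redex(1)[OF 1(1,2)] redex(1)[OF 2(1,2)] by blast
  then have eq: "E = E'" "subst_trm \<sigma> l = subst_trm \<tau> l'"
    using plug_Fun_unique[OF 1(3) 2(3), of f ts f' ts'] 1(4) 2(4) by auto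
  \<comment> \<open>The shared redex is an overlap of the two left-hand sides at the root.\<close>
  have "unifiable_apart R l l'"
    unfolding unifiable_apart_def
    using eq(2) 1(2) 2(2) by (intro exI[of _ \<sigma>] exI[of _ \<tau>]) (auto simp: is_subst_def is_value_is_trm)
  moreover have "non_overlapping R (rules R)" using R by (simp add: is_strs_def)
  ultimately have "(l, r) = (l', r')"
    using 1(1) 2(1) redex(3,4)[OF 1(1,2)] unfolding non_overlapping_def by fastforce
  then have "subst_trm \<sigma> r = subst_trm \<tau> r'"
    using eq(2) redex(2)[OF 1(1,2)] by (auto intro!: subst_cong_on_vars intro: subst_eq_on_vars)
  then show ?thesis using 1(5) 2(5) eq(1) by simp
qed


section \<open>Reduction modulo equivalence\<close>

lemma step_ground: "step R N s t \<Longrightarrow> s \<in> ground_trms R \<and> t \<in> ground_trms R"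
  by (induction rule: step.induct) auto

text \<open>A contractum can be ill-formed when a variable inside an amplitude receives a value that
  is not a natural; rule \<open>C\<close> then gives no step, hence the test for a ground
  contractum. Without one the term stays fixed, like a normal form in rule \<open>Q\<close>.\<close>

definition reduct :: "('x, 'a, 'c, 'f) strs \<Rightarrow> ('x, 'a, 'c, 'f) trm \<Rightarrow> ('x, 'a, 'c, 'f) trm" where
  "reduct R s =
     (if \<exists>t\<in>ground_trms R. contracts R s t then THE t. contracts R s t else s)"

lemma reduct_contracts:
  assumes "is_strs R" "contracts R s t" "t \<in> ground_trms R"
  shows "reduct R s = t"
proof -
  have "(THE t. contracts R s t) = t"
    using assms(2) by (rule the_equality) (rule contracts_unique[OF assms(1) _ assms(2)])
  then show ?thesis using assms(2,3) by (auto simp: reduct_def)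
qed

definition linear_reduct ::
    "('x, 'a, 'c, 'f) strs \<Rightarrow> (('x, 'a, 'c, 'f) trm \<Rightarrow> complex) \<Rightarrow>
     ('x, 'a, 'c, 'f) trm \<Rightarrow> complex" where
  "linear_reduct R v k = (\<Sum>j | v j \<noteq> 0. v j * coef R (reduct R j) k)"

lemma linear_reduct_classical:
  "classical s \<Longrightarrow> linear_reduct R (coef R s) k = coef R (reduct R s) k"
  by (simp add: linear_reduct_def coef_classical)

text \<open>The hypothesis on \<open>N\<close> makes \<open>reduct\<close> fix the classical members
  of \<open>N\<close>. Contraction sends one basis vector to that of its reduct, equivalence keeps
  the vector, and in rule \<open>Q\<close> every summand, resting or stepping, turns into the vector
  of its reduct.\<close>

lemma coef_step:
  assumes R: "is_strs R" and N: "\<And>s t. s \<in> N \<Longrightarrow> classical s \<Longrightarrow> contracts R s t \<Longrightarrow> t \<notin> ground_trms R"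
  shows "step R N s t \<Longrightarrow> coef R t k = linear_reduct R (coef R s) k"
proof (induction arbitrary: k rule: step.induct)
  case (C l r \<sigma> E)
  have "contracts R (plug E (subst_trm \<sigma> l)) (plug E (subst_trm \<sigma> r))"
    unfolding contracts_def using C.hyps(1-3) by blast
  from reduct_contracts[OF R this C.hyps(6)] show ?case
    using C.hyps(4) by (simp add: linear_reduct_classical)
next
  case (E s s' t' t)
  have "coef R s = coef R s'" using coef_eqv[OF R E.hyps(1)] by blast
  then show ?case using coef_eqv[OF R E.hyps(3), of k] E.IH[of k] by simp
next
  case (Q \<alpha>s ss ts)
  let ?n = "length ss"
  let ?v = "coef R (lincomb (zip \<alpha>s ss))"
  have mem: "(\<alpha>s ! i, ss ! i) \<in> set (zip \<alpha>s ss)" if "i < ?n" for i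
    using Q.hyps(1) that by (auto simp: set_zip)
  have cl: "classical (ss ! i)" if "i < ?n" for i
    using Q.hyps(3) mem[OF that] by (force simp: canonical_def)
  have v: "?v (ss ! i) = amp0 R (\<alpha>s ! i)" if "i < ?n" for i
    using coef_lincomb_in[OF Q.hyps(3) mem[OF that]] .
  have nz: "amp0 R (\<alpha>s ! i) \<noteq> 0" if "i < ?n" for i
    using Q.hyps(3) mem[OF that] amp0_denotes[OF R] unfolding canonical_def by fastforce
  have snd: "map snd (zip \<alpha>s ss) = ss" using Q.hyps(1) by simp
  have "distinct ss" "ss \<noteq> []" using Q.hyps(3) snd by (auto simp: canonical_def)
  \<comment> \<open>Distinct classical terms with non-zero amplitudes cannot cancel, so the support
    is exactly \<open>ss\<close>.\<close>
  have supp: "{j. ?v j \<noteq> 0} = set ss"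
  proof
    show "{j. ?v j \<noteq> 0} \<subseteq> set ss"
      using coef_lincomb_notin[OF Q.hyps(3)] arg_cong[OF snd, of set] by auto
    show "set ss \<subseteq> {j. ?v j \<noteq> 0}" using v nz by (auto simp: in_set_conv_nth)
  qed
  have red: "coef R (ts ! i) k = coef R (reduct R (ss ! i)) k" if i: "i < ?n" for i
  proof (cases "ss ! i \<in> N \<and> ts ! i = ss ! i")
    case True
    then show ?thesis using N[OF _ cl[OF i]] by (auto simp: reduct_def)
  next
    case False
    then have "coef R (ts ! i) k = linear_reduct R (coef R (ss ! i)) k"
      using Q.IH(1) i by auto
    then show ?thesis using linear_reduct_classical[OF cl[OF i]] by simp
  qed
  \<comment> \<open>The terms in \<open>ts\<close> may coincide or be non-classical, so this side is
    evaluated by linearity of \<open>coef\<close> and not as a canonical form.\<close>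
  have "zip \<alpha>s ts \<noteq> []" using \<open>ss \<noteq> []\<close> Q.hyps(1,2) by auto
  then have "coef R (lincomb (zip \<alpha>s ts)) k = (\<Sum>i<?n. amp0 R (\<alpha>s ! i) * coef R (ts ! i) k)"
    using Q.hyps(1,2) by (simp add: coef_lincomb sum_list_sum_nth atLeast0LessThan)
  also have "\<dots> = (\<Sum>i<?n. ?v (ss ! i) * coef R (reduct R (ss ! i)) k)"
    using v red by (intro sum.cong) auto
  also have "\<dots> = (\<Sum>j\<in>set ss. ?v j * coef R (reduct R j) k)"
    using bij_betw_nth[OF \<open>distinct ss\<close> HOL.refl HOL.refl] by (rule sum.reindex_bij_betw)
  finally show ?case using supp by (simp add: linear_reduct_def)
qed

section \<open>From single steps to the relation \<open>red\<close> and its closure\<close>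

lemma red_ground: "is_strs R \<Longrightarrow> red R s t \<Longrightarrow> s \<in> ground_trms R \<and> t \<in> ground_trms R"
  using step_ground red_unfold by metis

lemma reds_ground: "is_strs R \<Longrightarrow> (red R)\<^sup>*\<^sup>* s t \<Longrightarrow> s \<in> ground_trms R \<Longrightarrow> t \<in> ground_trms R"
  by (erule rtranclp_induct) (auto dest: red_ground)

lemma coef_red:
  assumes R: "is_strs R" and "red R s t"
  shows "coef R t = linear_reduct R (coef R s)"
proof
  fix k
  \<comment> \<open>A classical normal form with a ground contractum could take a \<open>C\<close>
    step; this contradiction discharges the hypothesis of \<open>coef_step\<close> on
    \<open>N\<close>.\<close>
  have "t \<notin> ground_trms R" if "s \<in> nfs R (red R)" "classical s" "contracts R s t" for s t
  proof
    assume "t \<in> ground_trms R"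
    then have "step R (nfs R (red R)) s t"
      using that step.C[of _ _ R] unfolding contracts_def nfs_def by blast
    then show False using that(1) red_unfold[OF R] by (auto simp: nfs_def)
  qed
  moreover have "step R (nfs R (red R)) s t" using assms red_unfold by metis
  ultimately show "coef R t k = linear_reduct R (coef R s) k" by (rule coef_step[OF R])
qed

lemma red_eqv:
  assumes R: "is_strs R" and "red R s t" "eqv R s s'" "s' \<in> ground_trms R"
  shows "red R s' t"
proof -
  have "t \<in> ground_trms R" "step R (nfs R (red R)) s t"
    using red_ground[OF assms(1,2)] red_unfold[OF R] assms(2) by metis+
  then have "step R (nfs R (red R)) s' t"
    using assms(3,4) by (auto intro: step.E eqv.sym eqv.refl simp: ground_trms_def)
  then show ?thesis using red_unfold[OF R] by simp
qed

text \<open>Both targets carry the image of one coefficient vector under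
  \<open>linear_reduct\<close>, and ground terms with equal vectors are equivalent.\<close>

lemma red_deterministic:
  assumes "is_strs R" "red R s t" "red R s' t'" "eqv R s s'"
  shows "eqv R t t'"
proof -
  have "coef R s = coef R s'" using coef_eqv[OF assms(1,4)] by blast
  then have "coef R t = coef R t'"
    using coef_red[OF assms(1,2)] coef_red[OF assms(1,3)] by simp
  then show ?thesis using eqv_if_coef_eq red_ground assms by metis
qed

text \<open>The sources are only assumed equivalent because, after one step on each side,
  \<open>red_deterministic\<close> gives no more than that. The reductions advance in lockstep until
  one ends; the other then goes on from an equivalent term.\<close>

lemma red_semi_confluent:
  assumes "is_strs R"
  shows "(red R)\<^sup>*\<^sup>* s t \<Longrightarrow> (red R)\<^sup>*\<^sup>* s' t' \<Longrightarrow> eqv R s s' \<Longrightarrow> s \<in> ground_trms R \<Longrightarrow>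
    s' \<in> ground_trms R \<Longrightarrow>
    \<exists>u u'. (red R)\<^sup>*\<^sup>* t u \<and> (red R)\<^sup>*\<^sup>* t' u' \<and> eqv R u u'"
proof (induction arbitrary: s' rule: converse_rtranclp_induct)
  case base
  from base(1) show ?case
  proof (cases rule: converse_rtranclpE)
    case base
    then show ?thesis using \<open>eqv R t s'\<close> by blast
  next
    case (step y)
    \<comment> \<open>The first reduction has ended at \<open>t\<close>, so \<open>red_eqv\<close>
      lets the rest of the second start there, and both sides meet at \<open>t'\<close>.\<close>
    have "red R t y" using red_eqv[OF assms step(1)] base eqv.sym by blast
    then have "(red R)\<^sup>*\<^sup>* t t'" using step(2) by (rule converse_rtranclp_into_rtranclp)
    moreover have "is_trm R t'"
      using reds_ground[OF assms step(2)] red_ground[OF assms step(1)] by (simp add: ground_trms_def)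
    ultimately show ?thesis using eqv.refl by blast
  qed
next
  case (step s v)
  show ?case
    using step.prems(1)
  proof (cases rule: converse_rtranclpE)
    case base
    then have "red R t' v" using red_eqv[OF assms step.hyps(1)] step.prems by blast
    then have "(red R)\<^sup>*\<^sup>* t' t" using step.hyps(2) by (rule converse_rtranclp_into_rtranclp)
    moreover have "is_trm R t"
      using reds_ground[OF assms step.hyps(2)] red_ground[OF assms step.hyps(1)]
      by (simp add: ground_trms_def)
    ultimately show ?thesis using eqv.refl by blast
  next
    case (step w)
    \<comment> \<open>Both reductions step, to \<open>v\<close> and \<open>w\<close>; these are
      equivalent by determinism, so the induction hypothesis applies to what remains.\<close>
    then show ?thesis
      using step.IH red_deterministic[OF assms] red_ground[OF assms] \<open>red R s v\<close> \<open>eqv R s s'\<close>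
      by blast
  qed
qed

theorem lemma10:
  fixes R :: "('x::countable, 'a, 'c, 'f) strs"
    and t t1 t2 :: "('x, 'a, 'c, 'f) trm"
  assumes "is_strs R"
    and "is_trm R t" and "is_trm R t1" and "is_trm R t2"
    and "(red R)\<^sup>*\<^sup>* t t1" and "(red R)\<^sup>*\<^sup>* t t2"
  shows "\<exists>t3 t4. is_trm R t3 \<and> is_trm R t4 \<and>
           (red R)\<^sup>*\<^sup>* t1 t3 \<and> (red R)\<^sup>*\<^sup>* t2 t4 \<and> eqv R t3 t4"
proof (cases "t \<in> ground_trms R")
  case True
  then show ?thesis
    using red_semi_confluent[OF assms(1,5,6)] eqv.refl[OF assms(2)] eqv_is_trm by blast
next
  case False
  \<comment> \<open>\<open>red\<close> relates ground terms only, so both reductions from a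
    non-ground term are empty.\<close>
  then have "t1 = t" "t2 = t"
    using assms(5,6) red_ground[OF assms(1)] by (auto elim: converse_rtranclpE)
  then show ?thesis using eqv.refl[OF assms(2)] assms(2) by blast
qed

end
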